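(* A function $G:\mathbb{R}\to\mathbb{R}$ is a measurable solution of the conditional Cauchy functional equation $$G(x^2-y^2)=G(x^2)-G(y^2)\quad\text{for all } x,y\in\mathbb{R}$$ if and only if the process $(G(W_t),t\ge 0)$ is an $(\mathcal{F}_t)$-martingale with $P$-a.s. right-continuous paths, zero at time zero.
   Context: $W=(W_t,t\ge 0)$ is a standard Brownian motion (so $W_0=0$) on a complete probability space $(\Omega,\mathcal{F},P)$. $(\mathcal{F}_t)_{t\ge 0}$ is a filtration satisfying the usual conditions of right-continuity and completeness, containing the filtration generated by $W$, such that $W_t-W_s$ is independent of $\mathcal{F}_s$ whenever $0\le s\le t$ (so $W$ is a Brownian motion with respect to $(\mathcal{F}_t)$), and large enough to support an additional Brownian motion $B$ independent of $W$. "Measurable" means Lebesgue measurable; only Lebesgue measurable real functions are considered. *)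

theory Defs
  imports "HOL-Probability.Probability"
begin

text \<open>Processes and filtrations are indexed by \<^typ>\<open>real\<close>, but only times \<open>t \<ge> 0\<close> are constrained:
  values at negative times are irrelevant. (The locale \<open>filtration\<close> of
  \<open>HOL-Probability.Stopping_Time\<close> would constrain them.) Of a member \<open>F t\<close> of a filtration only the
  sigma-algebra \<open>sets (F t)\<close> matters; the probability is always that of \<open>M\<close>.\<close>

definition filtration_on :: "'a measure \<Rightarrow> (real \<Rightarrow> 'a measure) \<Rightarrow> bool" where
  "filtration_on M F \<longleftrightarrow>
     (\<forall>t\<ge>0. subalgebra M (F t)) \<and>
     (\<forall>s t. 0 \<le> s \<and> s \<le> t \<longrightarrow> sets (F s) \<subseteq> sets (F t))"

text \<open>For a complete measure \<open>M\<close> all subsets of null sets are in \<^term>\<open>null_sets M\<close>.\<close>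

definition usual_conditions :: "'a measure \<Rightarrow> (real \<Rightarrow> 'a measure) \<Rightarrow> bool" where
  "usual_conditions M F \<longleftrightarrow>
     (\<forall>t\<ge>0. sets (F t) = (\<Inter>s\<in>{t<..}. sets (F s))) \<and>
     (\<forall>t\<ge>0. null_sets M \<subseteq> sets (F t))"

definition adapted :: "(real \<Rightarrow> 'a measure) \<Rightarrow> (real \<Rightarrow> 'a \<Rightarrow> real) \<Rightarrow> bool" where
  "adapted F X \<longleftrightarrow> (\<forall>t\<ge>0. X t \<in> borel_measurable (F t))"

definition standard_brownian_motion :: "'a measure \<Rightarrow> (real \<Rightarrow> 'a \<Rightarrow> real) \<Rightarrow> bool" where
  "standard_brownian_motion M X \<longleftrightarrow>
     (\<forall>t\<ge>0. X t \<in> borel_measurable M) \<and>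
     (AE \<omega> in M. X 0 \<omega> = 0) \<and>
     (\<forall>n (\<tau> :: nat \<Rightarrow> real). 0 \<le> \<tau> 0 \<and> (\<forall>i<n. \<tau> i \<le> \<tau> (Suc i)) \<longrightarrow>
        prob_space.indep_vars M (\<lambda>_. borel) (\<lambda>i \<omega>. X (\<tau> (Suc i)) \<omega> - X (\<tau> i) \<omega>) {..<n}) \<and>
     (\<forall>s t. 0 \<le> s \<and> s < t \<longrightarrow>
        distributed M lborel (\<lambda>\<omega>. X t \<omega> - X s \<omega>) (normal_density 0 (sqrt (t - s)))) \<and>
     (AE \<omega> in M. continuous_on {0..} (\<lambda>t. X t \<omega>))"

definition increments_independent_of ::
    "'a measure \<Rightarrow> (real \<Rightarrow> 'a measure) \<Rightarrow> (real \<Rightarrow> 'a \<Rightarrow> real) \<Rightarrow> bool" where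
  "increments_independent_of M F X \<longleftrightarrow>
     (\<forall>s t. 0 \<le> s \<and> s \<le> t \<longrightarrow>
        prob_space.indep_set M (sets (F s))
          (sets (vimage_algebra (space M) (\<lambda>\<omega>. X t \<omega> - X s \<omega>) borel)))"

text \<open>Independence of the whole processes, regarded as random elements of the product space
  of all real functions on \<open>[0, \<infinity>)\<close>.\<close>

definition independent_processes ::
    "'a measure \<Rightarrow> (real \<Rightarrow> 'a \<Rightarrow> real) \<Rightarrow> (real \<Rightarrow> 'a \<Rightarrow> real) \<Rightarrow> bool" where
  "independent_processes M X Y \<longleftrightarrow>
     prob_space.indep_var M
       (Pi\<^sub>M {0..} (\<lambda>_. borel)) (\<lambda>\<omega>. \<lambda>t\<in>{0..}. X t \<omega>)
       (Pi\<^sub>M {0..} (\<lambda>_. borel)) (\<lambda>\<omega>. \<lambda>t\<in>{0..}. Y t \<omega>)"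

definition martingale :: "'a measure \<Rightarrow> (real \<Rightarrow> 'a measure) \<Rightarrow> (real \<Rightarrow> 'a \<Rightarrow> real) \<Rightarrow> bool" where
  "martingale M F X \<longleftrightarrow>
     adapted F X \<and>
     (\<forall>t\<ge>0. integrable M (X t)) \<and>
     (\<forall>s t. 0 \<le> s \<and> s \<le> t \<longrightarrow> (AE \<omega> in M. real_cond_exp M (F s) (X t) \<omega> = X s \<omega>))"

end

theory Submission
  imports Defs "HOL-Real_Asymp.Real_Asymp"
begin

text \<open>
  Both sides of the equivalence say that \<open>G x = x * G 1\<close>.

  The conditional functional equation says \<open>G (a - b) = G a - G b\<close> for \<open>a, b \<ge> 0\<close>, which already
  forces additivity on the whole line; a Lebesgue measurable additive function is linear
  (\<open>lebesgue_measurable_additive_linear\<close>), and a multiple of Brownian motion is a continuous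
  martingale (\<open>martingale_scaled_W\<close>).

  Conversely, let \<open>G (W t)\<close> be a martingale with right-continuous paths. Nothing is known about the
  regularity of \<open>G\<close> beforehand, but the paths carry it: with positive probability \<open>W\<close> is below a
  given level \<open>x\<close> at time 1 and above it at time 2. After the last visit to \<open>x\<close> in between, such a
  path runs through all values slightly above \<open>x\<close>, so right-continuity of \<open>G (W t)\<close> at that single
  instant is right-continuity of \<open>G\<close> at \<open>x\<close>. Downcrossings give left-continuity. Hence \<open>G\<close> is
  continuous everywhere (\<open>continuous_of_right_continuous_along_W\<close>).

  Since the increment of \<open>W\<close> after time 1 is Gaussian and independent of the past, the martingale
  property makes \<open>G\<close> almost everywhere equal to its convolution with every centred Gaussian; both
  sides being continuous, they agree everywhere (\<open>martingale_imp_heat_invariant\<close>). Such a \<open>G\<close> is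
  affine. This is a maximum principle: if \<open>G\<close> exceeded its chord over an interval, then \<open>G\<close> minus the
  chord plus a small parabola \<open>e * (x - a) * (x - b)\<close> would have an interior maximum; Gaussian averaging
  with variance \<open>h\<close> raises this function by exactly \<open>e * h\<close>, whereas near a local maximum averaging can
  raise it only through the Gaussian tails, whose contribution is \<open>o(h)\<close> as \<open>h\<close> tends to 0
  (\<open>no_strict_heat_growth_at_local_max\<close>). Finally \<open>G 0 = 0\<close> because \<open>W\<close> starts at 0.
\<close>

section \<open>Measurable additive functions\<close>

text \<open>The sets on which \<open>\<bar>G\<bar> \<le> n\<close> exhaust the unit interval, so one of them has measure close
  to 1 there and must meet its own small translates. Hence every small \<open>t\<close> is a difference of two
  points at which \<open>\<bar>G\<bar> \<le> n\<close>, and \<open>G\<close> is bounded near 0. The defect \<open>G x - x * G 1\<close> is then additive,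
  periodic and bounded, hence zero.\<close>

lemma lebesgue_measurable_additive_linear:
  fixes G :: "real \<Rightarrow> real"
  assumes meas: "G \<in> borel_measurable lebesgue"
    and add: "\<And>x y. G (x + y) = G x + G y"
  shows "G x = x * G 1"
proof -
  define A where "A n = {x \<in> {0..1}. \<bar>G x\<bar> \<le> real n}" for n
  have A_sets: "A n \<in> sets lebesgue" for n
  proof -
    note [measurable] = meas
    have "{x \<in> space lebesgue. \<bar>G x\<bar> \<le> real n} \<in> sets lebesgue"
      by measurable
    then have "{0..1} \<inter> {x. \<bar>G x\<bar> \<le> real n} \<in> sets lebesgue"
      by (intro sets.Int) auto
    then show ?thesis by (simp add: A_def Int_def)
  qed
  have A_sub: "A n \<subseteq> {0..1}" for n by (auto simp: A_def)
  have A_meas: "A n \<in> lmeasurable" for n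
    using A_sub A_sets by (meson bounded_closed_interval bounded_set_imp_lmeasurable bounded_subset)
  have union: "(\<Union>n. A n) = {0..1}"
    by (auto simp: A_def intro: real_arch_simple)
  have "(\<lambda>n. measure lebesgue (A n)) \<longlonglongrightarrow> measure lebesgue (\<Union>n. A n)"
  proof (rule Lim_measure_incseq)
    show "range A \<subseteq> sets lebesgue" using A_sets by auto
    show "incseq A" by (auto simp: incseq_def A_def)
    show "emeasure lebesgue (\<Union>n. A n) \<noteq> \<infinity>" by (simp add: union)
  qed
  then have "(\<lambda>n. measure lebesgue (A n)) \<longlonglongrightarrow> 1" by (simp add: union)
  then have "\<forall>\<^sub>F n in sequentially. 3/4 < measure lebesgue (A n)"
    by (rule order_tendstoD) simp
  then obtain n where n: "3/4 < measure lebesgue (A n)"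
    by (meson eventually_happens' sequentially_bot)
  have add0: "G 0 = 0" using add[of 0 0] by simp
  have minus: "G (- x) = - G x" for x using add[of x "-x"] add0 by simp
  have diff: "G (x - y) = G x - G y" for x y using add[of x "-y"] minus by simp
  have small: "\<bar>G t\<bar> \<le> 2 * real n" if t: "\<bar>t\<bar> \<le> 1/4" for t
  proof -
    \<comment> \<open>\<open>A n\<close> and its translate both lie in an interval of length \<open>3/2\<close>, so they must meet.\<close>
    have "A n \<inter> (+) t ` A n \<noteq> {}"
    proof
      assume disj: "A n \<inter> (+) t ` A n = {}"
      have tm: "(+) t ` A n \<in> lmeasurable" by (rule measurable_translation[OF A_meas])
      have "2 * measure lebesgue (A n) = measure lebesgue (A n \<union> (+) t ` A n)"
        using measure_Un3[OF A_meas tm] disj by (simp add: measure_translation)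
      also have "\<dots> \<le> measure lebesgue {-1/4..5/4::real}"
      proof (rule measure_mono_fmeasurable)
        show "A n \<union> (+) t ` A n \<subseteq> {-1/4..5/4}" using A_sub[of n] t by fastforce
        show "A n \<union> (+) t ` A n \<in> sets lebesgue" using A_meas tm by auto
      qed simp
      finally show False using n by simp
    qed
    then obtain a where "a \<in> A n" "t + a \<in> A n" by auto
    then have "\<bar>G a\<bar> \<le> real n" "\<bar>G (t + a)\<bar> \<le> real n" by (auto simp: A_def)
    then show ?thesis by (simp add: add)
  qed
  \<comment> \<open>Subtracting the candidate linear function leaves an additive function with period \<open>1/4\<close>.\<close>
  define H where "H x = G x - x * G 1" for x
  have H_add: "H (x + y) = H x + H y" for x y by (simp add: H_def add algebra_simps)
  have H_nat: "H (real k * x) = real k * H x" for k x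
  proof (induction k)
    case 0 then show ?case by (simp add: H_def add0)
  next
    case (Suc k) then show ?case using H_add[of x "real k * x"] by (simp add: algebra_simps)
  qed
  have H_quarter: "H (1/4) = 0" using H_nat[of 4 "1/4"] by (simp add: H_def)
  have H_minus: "H (- x) = - H x" for x by (simp add: H_def minus)
  have H_int: "H (of_int k * (1/4)) = 0" for k
  proof (cases "k \<ge> 0")
    case True then show ?thesis using H_nat[of "nat k" "1/4"] H_quarter by simp
  next
    case False then show ?thesis
      using H_nat[of "nat (-k)" "1/4"] H_quarter H_minus[of "of_int k * (1/4)"] by simp
  qed
  define C where "C = 2 * real n + \<bar>G 1\<bar>"
  have H_bdd: "\<bar>H x\<bar> \<le> C" for x
  proof -
    define r where "r = x - of_int \<lfloor>4 * x\<rfloor> * (1/4)"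
    have r: "\<bar>r\<bar> \<le> 1/4" unfolding r_def by linarith
    have "H x = H r" using H_add[of r "of_int \<lfloor>4 * x\<rfloor> * (1/4)"] H_int by (simp add: r_def)
    moreover have "\<bar>r * G 1\<bar> \<le> \<bar>G 1\<bar>" using r
      by (simp add: abs_mult mult_left_le_one_le)
    ultimately show ?thesis using small[OF r] unfolding H_def C_def by linarith
  qed
  have "H x = 0"
  proof (rule ccontr)
    assume "H x \<noteq> 0"
    then obtain k :: nat where "C < real k * \<bar>H x\<bar>"
      using ex_less_of_nat_mult[of "\<bar>H x\<bar>" C] by auto
    then show False using H_bdd[of "real k * x"] by (simp add: H_nat abs_mult)
  qed
  then show ?thesis by (simp add: H_def)
qed

text \<open>Every nonnegative real is a square, so the equation allows arbitrary \<open>a, b \<ge> 0\<close> in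
  \<open>G (a - b) = G a - G b\<close>; oddness of \<open>G\<close> (the case \<open>a = 0\<close>) takes care of the other signs.\<close>

lemma conditional_Cauchy_imp_additive:
  fixes G :: "real \<Rightarrow> real"
  assumes eq: "\<And>x y. G (x\<^sup>2 - y\<^sup>2) = G (x\<^sup>2) - G (y\<^sup>2)"
  shows "G (x + y) = G x + G y"
proof -
  have diff: "G (a - b) = G a - G b" if "a \<ge> 0" "b \<ge> 0" for a b
    using eq[of "sqrt a" "sqrt b"] that by simp
  have G0: "G 0 = 0" using diff[of 0 0] by simp
  have minus: "G (- b) = - G b" for b
    using diff[of 0 b] diff[of 0 "-b"] G0 by (cases "b \<ge> 0") auto
  have pos: "G (a + b) = G a + G b" if "a \<ge> 0" "b \<ge> 0" for a b
    using diff[of "a + b" b] that by simp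
  show ?thesis
    using pos[of x y] diff[of x "-y"] diff[of y "-x"] pos[of "-x" "-y"] minus[of x] minus[of y]
      minus[of "x + y"]
    by (cases "x \<ge> 0"; cases "y \<ge> 0") (auto simp: algebra_simps)
qed

section \<open>Continuity detected along a continuous path\<close>

text \<open>At the last instant \<open>L\<close> before \<open>t\<close> at which \<open>w \<le> x\<close>, the path sits at \<open>x\<close> and afterwards
  covers a whole interval \<open>(x, x + \<delta>)\<close> in an arbitrarily short time. So the limit of \<open>G (w r)\<close> as \<open>r\<close>
  decreases to \<open>L\<close> controls all values of \<open>G\<close> just to the right of \<open>x\<close>.\<close>

lemma continuous_at_right_of_upcrossing:
  fixes w :: "real \<Rightarrow> real" and G :: "real \<Rightarrow> real"
  assumes w: "continuous_on {0..} w"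
    and Gw: "\<And>t. t \<ge> 0 \<Longrightarrow> continuous (at_right t) (\<lambda>s. G (w s))"
    and st: "0 \<le> s" "s < t" and cross: "w s \<le> x" "x < w t"
  shows "continuous (at_right x) G"
proof -
  define S where "S = {r \<in> {s..t}. w r \<le> x}"
  have wst: "continuous_on {a..b} w" if "0 \<le> a" for a b
    using w by (rule continuous_on_subset) (use that in auto)
  have "closed S" unfolding S_def
    by (intro continuous_on_closed_Collect_le wst st continuous_on_const closed_atLeastAtMost)
  then have "compact S"
    using compact_Int_closed[OF compact_Icc, of S s t] by (simp add: S_def Int_def conj_ac)
  moreover have "s \<in> S" using st cross by (auto simp: S_def)
  ultimately obtain L where L: "L \<in> S" "\<And>r. r \<in> S \<Longrightarrow> r \<le> L"
    using compact_attains_sup[of S] by blast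
  have Lr: "s \<le> L" "L \<le> t" "w L \<le> x" using L by (auto simp: S_def)
  have "L < t" using Lr cross by (cases "L = t") auto
  have above: "x < w r" if "L < r" "r \<le> t" for r
    using L(2)[of r] that Lr by (force simp: S_def)
  obtain r where "L \<le> r" "r \<le> t" "w r = x"
    using IVT'[of w L x t] Lr cross wst[of L t] st by auto
  then have wL: "w L = x" using above[of r] by (cases "r = L") auto
  have lim: "((\<lambda>r. G (w r)) \<longlongrightarrow> G x) (at_right L)"
    using Gw[of L] Lr st wL by (simp add: continuous_within)
  show ?thesis
    unfolding continuous_within
  proof (rule tendstoI)
    fix e :: real assume "e > 0"
    with lim have "\<forall>\<^sub>F r in at_right L. dist (G (w r)) (G x) < e" by (rule tendstoD)
    then obtain b where b: "b > L" "\<And>r. L < r \<Longrightarrow> r < b \<Longrightarrow> dist (G (w r)) (G x) < e"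
      unfolding eventually_at_right_field by auto
    define r0 where "r0 = min ((L + b) / 2) t"
    have r0: "L < r0" "r0 < b" "r0 \<le> t" using b \<open>L < t\<close> by (auto simp: r0_def min_def)
    have "dist (G y) (G x) < e" if y: "x < y" "y < w r0" for y
    proof -
      obtain r where "L \<le> r" "r \<le> r0" "w r = y"
        using IVT'[of w L y r0] y wL r0 wst[of L r0] Lr st by auto
      with wL y r0 b(2)[of r] show ?thesis by (cases "r = L") auto
    qed
    then show "\<forall>\<^sub>F y in at_right x. dist (G y) (G x) < e"
      unfolding eventually_at_right_field using above[OF r0(1,3)] by blast
  qed
qed

text \<open>Reflection of the path and of \<open>G\<close> reduces this to an upcrossing.\<close>

lemma continuous_at_left_of_downcrossing:
  fixes w :: "real \<Rightarrow> real" and G :: "real \<Rightarrow> real"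
  assumes w: "continuous_on {0..} w"
    and Gw: "\<And>t. t \<ge> 0 \<Longrightarrow> continuous (at_right t) (\<lambda>s. G (w s))"
    and st: "0 \<le> s" "s < t" and cross: "x \<le> w s" "w t < x"
  shows "continuous (at_left x) G"
proof -
  have "continuous (at_right (-x)) (\<lambda>y. G (- y))"
    by (rule continuous_at_right_of_upcrossing[where w = "\<lambda>s. - w s" and s = s and t = t])
       (use assms in \<open>auto intro!: continuous_intros\<close>)
  then show ?thesis
    unfolding continuous_within by (subst at_left_minus) (simp add: filterlim_filtermap)
qed

section \<open>Functions invariant under the heat semigroup\<close>

text \<open>The parameter is the variance, that is, the time of the heat flow.\<close>

abbreviation gauss :: "real \<Rightarrow> real \<Rightarrow> real" where
  "gauss h \<equiv> normal_density 0 (sqrt h)"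

text \<open>Fixed points of the heat semigroup, that is, functions invariant under convolution with every
  centred Gaussian. Stating the convolution through \<open>has_bochner_integral\<close> builds in its absolute
  convergence, so that these functions visibly form a vector space.\<close>

definition heat_invariant :: "(real \<Rightarrow> real) \<Rightarrow> bool" where
  "heat_invariant G \<longleftrightarrow> continuous_on UNIV G \<and>
     (\<forall>h>0. \<forall>x. has_bochner_integral lborel (\<lambda>y. gauss h y * G (x + y)) (G x))"

lemma gauss_moments:
  assumes "h > 0"
  shows "has_bochner_integral lborel (gauss h) 1"
    and "has_bochner_integral lborel (\<lambda>y. gauss h y * y) 0"
    and "has_bochner_integral lborel (\<lambda>y. gauss h y * y\<^sup>2) h"
  using normal_moment_even[of "sqrt h" 0 0] normal_moment_odd[of "sqrt h" 0 0]
    normal_moment_even[of "sqrt h" 0 1] assms by (auto simp: fact_numeral)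

text \<open>Quadratic functions are shifted by the variance times the leading coefficient; in particular
  affine functions are invariant.\<close>

lemma heat_operator_quadratic:
  assumes "h > 0"
  shows "has_bochner_integral lborel (\<lambda>y. gauss h y * (p + q * (x + y) + r * (x + y)\<^sup>2))
           (p + q * x + r * x\<^sup>2 + r * h)"
proof -
  have "has_bochner_integral lborel
      (\<lambda>y. gauss h y * (p + q * x + r * x\<^sup>2) + gauss h y * y * (q + 2 * r * x) + gauss h y * y\<^sup>2 * r)
      (1 * (p + q * x + r * x\<^sup>2) + 0 * (q + 2 * r * x) + h * r)"
    by (intro has_bochner_integral_add has_bochner_integral_mult_left gauss_moments assms)
  then show ?thesis by (simp add: algebra_simps power2_eq_square)
qed

lemma heat_invariant_minus: "heat_invariant G \<Longrightarrow> heat_invariant (\<lambda>x. - G x)"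
  unfolding heat_invariant_def
  by (auto intro!: continuous_intros dest: has_bochner_integral_minus)

lemma heat_invariant_add_affine:
  assumes "heat_invariant G"
  shows "heat_invariant (\<lambda>x. G x + (p + q * x))"
  unfolding heat_invariant_def
proof (intro conjI allI impI)
  show "continuous_on UNIV (\<lambda>x. G x + (p + q * x))"
    using assms by (auto simp: heat_invariant_def intro!: continuous_intros)
  fix h x :: real assume "h > 0"
  then have "has_bochner_integral lborel
      (\<lambda>y. gauss h y * G (x + y) + gauss h y * (p + q * (x + y) + 0 * (x + y)\<^sup>2))
      (G x + (p + q * x + 0 * x\<^sup>2 + 0 * h))"
    using assms by (intro has_bochner_integral_add heat_operator_quadratic)
      (auto simp: heat_invariant_def)
  then show "has_bochner_integral lborel (\<lambda>y. gauss h y * (G (x + y) + (p + q * (x + y))))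
      (G x + (p + q * x))"
    by (simp add: algebra_simps)
qed

text \<open>The ratio of the two densities is \<open>exp (- (y\<^sup>2 / 2) * (1 / h - 1)) / sqrt h\<close>, which decreases in
  \<open>\<bar>y\<bar>\<close> when \<open>h < 1\<close>.\<close>

lemma gauss_tail_comparison:
  assumes h: "0 < h" "h < 1" and d: "0 \<le> d" "d \<le> \<bar>y\<bar>"
  shows "gauss h y \<le> exp (- (d\<^sup>2 / 2) * (1 / h - 1)) / sqrt h * gauss 1 y"
proof -
  have d2: "d\<^sup>2 \<le> y\<^sup>2" using d abs_le_square_iff[of d y] by simp
  have "d\<^sup>2 * (1 / h - 1) \<le> y\<^sup>2 * (1 / h - 1)"
    using h by (intro mult_right_mono d2) (simp add: field_simps)
  moreover have "- y\<^sup>2 / (2 * h) = - (y\<^sup>2 * (1 / h - 1)) / 2 - y\<^sup>2 / 2"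
    using h by (simp add: field_simps)
  ultimately have "- y\<^sup>2 / (2 * h) \<le> - (d\<^sup>2 / 2) * (1 / h - 1) - y\<^sup>2 / 2"
    by simp
  then have "exp (- y\<^sup>2 / (2 * h)) \<le> exp (- (d\<^sup>2 / 2) * (1 / h - 1)) * exp (- y\<^sup>2 / 2)"
    by (simp add: exp_add[symmetric])
  then have "exp (- y\<^sup>2 / (2 * h)) / (sqrt (2 * pi) * sqrt h)
      \<le> exp (- (d\<^sup>2 / 2) * (1 / h - 1)) * exp (- y\<^sup>2 / 2) / (sqrt (2 * pi) * sqrt h)"
    using h by (intro divide_right_mono) auto
  then show ?thesis
    using h by (simp add: normal_density_def real_sqrt_mult mult_ac)
qed

text \<open>Near a local maximum only the values at distance more than \<open>d\<close> can make the Gaussian average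
  exceed \<open>K x\<close>. There \<open>gauss h\<close> is at most a factor times \<open>gauss 1\<close>, and as \<open>h\<close> tends to 0 this factor
  vanishes faster than \<open>h\<close>, so growth at a linear rate \<open>e * h\<close> is impossible.\<close>

lemma no_strict_heat_growth_at_local_max:
  fixes K :: "real \<Rightarrow> real"
  assumes e: "e > 0" and d: "d > 0"
    and max: "\<And>y. \<bar>y\<bar> \<le> d \<Longrightarrow> K (x + y) \<le> K x"
    and growth: "\<And>h. h > 0 \<Longrightarrow>
      has_bochner_integral lborel (\<lambda>y. gauss h y * K (x + y)) (K x + e * h)"
  shows False
proof -
  \<comment> \<open>the ratio bounding the tails of \<open>gauss h\<close> by those of \<open>gauss 1\<close>\<close>
  define c where "c h = exp (- (d\<^sup>2 / 2) * (1 / h - 1)) / sqrt h" for h :: real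
  have diff: "has_bochner_integral lborel (\<lambda>y. gauss h y * (K (x + y) - K x)) (e * h)"
    if "h > 0" for h
    using has_bochner_integral_diff[OF growth[OF that]
        has_bochner_integral_mult_left[OF gauss_moments(1)[OF that], of "K x"]]
    by (simp add: algebra_simps)
  define C where "C = (\<integral>y. \<bar>gauss 1 y * (K (x + y) - K x)\<bar> \<partial>lborel)"
  have int1: "integrable lborel (\<lambda>y. \<bar>gauss 1 y * (K (x + y) - K x)\<bar>)"
    using diff[of 1] by (intro integrable_abs) (auto simp: has_bochner_integral_iff)
  have bound: "e \<le> C * (c h / h)" if h: "0 < h" "h < 1" for h
  proof -
    have "c h \<ge> 0" using h by (simp add: c_def)
    have "e * h = (\<integral>y. gauss h y * (K (x + y) - K x) \<partial>lborel)"
      using diff[OF h(1)] by (simp add: has_bochner_integral_iff)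
    also have "\<dots> \<le> (\<integral>y. c h * \<bar>gauss 1 y * (K (x + y) - K x)\<bar> \<partial>lborel)"
    proof (rule integral_mono)
      show "integrable lborel (\<lambda>y. gauss h y * (K (x + y) - K x))"
        using diff[OF h(1)] by (simp add: has_bochner_integral_iff)
      show "integrable lborel (\<lambda>y. c h * \<bar>gauss 1 y * (K (x + y) - K x)\<bar>)"
        using int1 by simp
      fix y
      show "gauss h y * (K (x + y) - K x) \<le> c h * \<bar>gauss 1 y * (K (x + y) - K x)\<bar>"
      proof (cases "\<bar>y\<bar> \<le> d")
        case True
        then have "gauss h y * (K (x + y) - K x) \<le> 0"
          using max[of y] by (intro mult_nonneg_nonpos) auto
        then show ?thesis using \<open>c h \<ge> 0\<close> by (smt (verit) mult_nonneg_nonneg abs_ge_zero)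
      next
        case False
        have "gauss h y * (K (x + y) - K x) \<le> gauss h y * \<bar>K (x + y) - K x\<bar>"
          by (intro mult_left_mono) auto
        also have "\<dots> \<le> (c h * gauss 1 y) * \<bar>K (x + y) - K x\<bar>"
          using gauss_tail_comparison[OF h, of d y] d False
          by (intro mult_right_mono) (auto simp: c_def)
        finally show ?thesis by (simp add: abs_mult mult.assoc)
      qed
    qed
    also have "\<dots> = c h * C" by (simp add: C_def)
    finally show ?thesis using h by (simp add: field_simps)
  qed
  have "((\<lambda>h. c h / h) \<longlongrightarrow> 0) (at_right 0)"
    unfolding c_def using d by real_asymp
  then have "((\<lambda>h. C * (c h / h)) \<longlongrightarrow> 0) (at_right 0)"
    by (rule tendsto_mult_right_zero)
  moreover have "\<forall>\<^sub>F h in at_right 0. e \<le> C * (c h / h)"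
    unfolding eventually_at_right_field using bound by (intro exI[of _ 1]) auto
  ultimately have "e \<le> 0"
    by (rule tendsto_lowerbound) simp
  with e show False by simp
qed

text \<open>If \<open>G c > 0\<close>, subtracting a small multiple of the concave parabola \<open>(x - a) * (b - x)\<close> keeps
  the value at \<open>c\<close> positive and those at the ends nonpositive, so the perturbed function has an interior
  maximum, while averaging makes it grow strictly.\<close>

lemma heat_invariant_maximum_principle:
  assumes G: "heat_invariant G" and ends: "G a \<le> 0" "G b \<le> 0" and c: "a \<le> c" "c \<le> b"
  shows "G c \<le> 0"
proof (rule ccontr)
  assume "\<not> G c \<le> 0"
  then have Gc: "G c > 0" by simp
  then have ac: "a < c" "c < b" using ends c by (cases "a = c"; cases "c = b"; auto)+
  \<comment> \<open>chosen so that the perturbation halves the value at \<open>c\<close>\<close>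
  define e where "e = G c / (2 * ((c - a) * (b - c)))"
  have prod: "(c - a) * (b - c) > 0" using ac by simp
  then have e: "e > 0" using Gc by (simp add: e_def)
  define K where "K x = G x + (e * a * b + (- e * (a + b)) * x + e * x\<^sup>2)" for x
  have K_alt: "K x = G x - e * ((x - a) * (b - x))" for x
    by (simp add: K_def algebra_simps power2_eq_square)
  have "K c = G c / 2" using ac by (simp add: K_alt e_def)
  then have Kc: "K c > 0" using Gc by simp
  have "continuous_on {a..b} K"
    using G unfolding K_def heat_invariant_def
    by (intro continuous_intros) (auto intro: continuous_on_subset)
  then obtain x where x: "x \<in> {a..b}" "\<And>y. y \<in> {a..b} \<Longrightarrow> K y \<le> K x"
    using continuous_attains_sup[of "{a..b}" K] c by auto
  have "K x > 0" using x(2)[of c] Kc c by auto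
  then have xab: "a < x" "x < b"
    using x(1) ends by (cases "a = x"; cases "x = b"; auto simp: K_alt)+
  show False
  proof (rule no_strict_heat_growth_at_local_max[of e "min (x - a) (b - x)" K x])
    show "e > 0" "min (x - a) (b - x) > 0" using e xab by auto
    show "K (x + y) \<le> K x" if "\<bar>y\<bar> \<le> min (x - a) (b - x)" for y
      using that by (intro x(2)) auto
    show "has_bochner_integral lborel (\<lambda>y. gauss h y * K (x + y)) (K x + e * h)" if "h > 0" for h
    proof -
      have "has_bochner_integral lborel (\<lambda>y. gauss h y * G (x + y) +
          gauss h y * (e * a * b + (- e * (a + b)) * (x + y) + e * (x + y)\<^sup>2))
          (G x + (e * a * b + (- e * (a + b)) * x + e * x\<^sup>2 + e * h))"
        using G that
        by (intro has_bochner_integral_add heat_operator_quadratic) (auto simp: heat_invariant_def)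
      then show ?thesis unfolding K_def by (simp only: distrib_left add.assoc)
    qed
  qed
qed

text \<open>Applying the maximum principle to the difference of \<open>G\<close> and its chord, and to its negative,
  identifies \<open>G\<close> with the chord over every symmetric interval.\<close>

lemma heat_invariant_imp_linear:
  assumes G: "heat_invariant G" and G0: "G 0 = 0"
  shows "G x = x * G 1"
proof -
  define R where "R = \<bar>x\<bar> + 1"
  have R: "R > 0" "-R \<le> x" "x \<le> R" "1 \<le> R" by (auto simp: R_def)
  define q where "q = (G R - G (-R)) / (2 * R)"
  define p where "p = (G R + G (-R)) / 2"
  \<comment> \<open>\<open>p + q * t\<close> interpolates \<open>G\<close> at \<open>-R\<close> and \<open>R\<close>.\<close>
  have interp: "p + q * R = G R" "p + q * (-R) = G (-R)"
    using R by (auto simp: p_def q_def field_simps)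
  have H: "heat_invariant (\<lambda>t. G t + (- p + (- q) * t))"
    by (rule heat_invariant_add_affine[OF G])
  have eq: "G t = p + q * t" if "-R \<le> t" "t \<le> R" for t
    using heat_invariant_maximum_principle[OF H, of "-R" R t]
      heat_invariant_maximum_principle[OF heat_invariant_minus[OF H], of "-R" R t] interp that
    by auto
  show ?thesis using eq[of 0] eq[of 1] eq[of x] R G0 by simp
qed

text \<open>Bounded shifts of a Gaussian are dominated by a single Gaussian of twice the variance, since
  \<open>(y - x)\<^sup>2 \<ge> y\<^sup>2 / 2 - x\<^sup>2\<close>.\<close>

lemma gauss_shift_bound:
  assumes h: "h > 0" and x: "\<bar>x\<bar> \<le> R"
  shows "gauss h (y - x) \<le> sqrt 2 * exp (R\<^sup>2 / (2 * h)) * gauss (2 * h) y"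
proof -
  have "x\<^sup>2 \<le> R\<^sup>2" using x abs_le_square_iff[of x R] by simp
  moreover have "0 \<le> (y - 2 * x)\<^sup>2" by simp
  ultimately have "y\<^sup>2 / 2 - R\<^sup>2 \<le> (y - x)\<^sup>2"
    by (simp add: power2_eq_square algebra_simps)
  then have "(y\<^sup>2 / 2 - R\<^sup>2) / (2 * h) \<le> (y - x)\<^sup>2 / (2 * h)"
    using h by (intro divide_right_mono) auto
  then have "exp (- (y - x)\<^sup>2 / (2 * h)) \<le> exp (R\<^sup>2 / (2 * h)) * exp (- y\<^sup>2 / (4 * h))"
    by (simp add: exp_add[symmetric] diff_divide_distrib)
  then have "exp (- (y - x)\<^sup>2 / (2 * h)) / (sqrt (2 * pi) * sqrt h)
      \<le> exp (R\<^sup>2 / (2 * h)) * exp (- y\<^sup>2 / (4 * h)) / (sqrt (2 * pi) * sqrt h)"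
    using h by (intro divide_right_mono) auto
  moreover have "sqrt 2 * exp (R\<^sup>2 / (2 * h)) * gauss (2 * h) y
      = exp (R\<^sup>2 / (2 * h)) * exp (- y\<^sup>2 / (4 * h)) / (sqrt (2 * pi) * sqrt h)"
  proof -
    have "sqrt (2 * pi * (sqrt (2 * h))\<^sup>2) = sqrt 2 * (sqrt (2 * pi) * sqrt h)"
      using h by (simp flip: real_sqrt_mult add: mult_ac)
    then have "gauss (2 * h) y = exp (- y\<^sup>2 / (4 * h)) / (sqrt 2 * (sqrt (2 * pi) * sqrt h))"
      using h by (simp only: normal_density_def) simp
    then show ?thesis by simp
  qed
  moreover have "gauss h (y - x) = exp (- (y - x)\<^sup>2 / (2 * h)) / (sqrt (2 * pi) * sqrt h)"
    using h by (simp add: normal_density_def real_sqrt_mult power_mult_distrib)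
  ultimately show ?thesis by simp
qed

text \<open>Moving the translation from \<open>G\<close> to the kernel makes the dependence on \<open>x\<close> continuous for each
  \<open>y\<close>, and the previous bound supplies the majorant for dominated convergence.\<close>

lemma
  fixes G :: "real \<Rightarrow> real"
  assumes [measurable]: "G \<in> borel_measurable borel"
    and int: "integrable lborel (\<lambda>y. gauss (2 * h) y * G y)" and h: "h > 0"
  shows integrable_heat_operator: "integrable lborel (\<lambda>y. gauss h y * G (x + y))"
    and continuous_heat_operator: "continuous_on UNIV (\<lambda>x. \<integral>y. gauss h y * G (x + y) \<partial>lborel)"
proof -
  define B where "B R y = sqrt 2 * exp (R\<^sup>2 / (2 * h)) * norm (gauss (2 * h) y * G y)" for R y
  have B_int: "integrable lborel (B R)" for R
    unfolding B_def using int by (intro integrable_mult_right integrable_norm)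
  have dom: "norm (gauss h (y - x) * G y) \<le> B R y" if "\<bar>x\<bar> \<le> R" for x y R
    using mult_right_mono[OF gauss_shift_bound[OF h that, of y], of "\<bar>G y\<bar>"]
    by (simp add: B_def abs_mult mult.assoc)
  have int': "integrable lborel (\<lambda>y. gauss h (y - x) * G y)" for x
    by (rule Bochner_Integration.integrable_bound[OF B_int[of "\<bar>x\<bar>"]])
       (auto intro!: AE_I2 order_trans[OF dom[OF order_refl, unfolded real_norm_def] abs_ge_self])
  show "integrable lborel (\<lambda>y. gauss h y * G (x + y))" for x
    using lborel_integrable_real_affine[OF int'[of x], of 1 x] by simp
  have shift: "(\<integral>y. gauss h y * G (x + y) \<partial>lborel) = (\<integral>y. gauss h (y - x) * G y \<partial>lborel)" for x
    by (subst (2) lborel_integral_real_affine[of 1 _ x]) simp_all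
  show "continuous_on UNIV (\<lambda>x. \<integral>y. gauss h y * G (x + y) \<partial>lborel)"
    unfolding shift continuous_on_sequentially
  proof (intro allI ballI impI, elim conjE, unfold comp_def)
    fix u :: "nat \<Rightarrow> real" and a assume u: "u \<longlonglongrightarrow> a"
    then obtain R where R: "\<And>n. \<bar>u n\<bar> \<le> R"
      using convergent_imp_Bseq[of u] unfolding convergent_def Bseq_def by auto
    show "(\<lambda>n. \<integral>y. gauss h (y - u n) * G y \<partial>lborel) \<longlonglongrightarrow> (\<integral>y. gauss h (y - a) * G y \<partial>lborel)"
    proof (rule integral_dominated_convergence[where w = "B R"])
      show "AE y in lborel. (\<lambda>n. gauss h (y - u n) * G y) \<longlonglongrightarrow> gauss h (y - a) * G y"
        unfolding normal_density_def using u h by (intro AE_I2 tendsto_intros) auto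
      show "AE y in lborel. norm (gauss h (y - u n) * G y) \<le> B R y" for n
        using dom[OF R] by simp
    qed (use B_int in auto)
  qed
qed

lemma AE_lborel_eq_imp_eq_of_continuous:
  fixes f g :: "real \<Rightarrow> real"
  assumes "continuous_on UNIV f" "continuous_on UNIV g" "AE x in lborel. f x = g x"
  shows "f = g"
proof -
  define S where "S = {x. f x \<noteq> g x}"
  have S: "open S" unfolding S_def using assms by (intro open_Collect_neq)
  have "AE x in lborel. x \<notin> S" using assms(3) by eventually_elim (simp add: S_def)
  then have "S \<in> null_sets lborel"
    using S by (subst (asm) AE_iff_null_sets[symmetric]) auto
  then have "negligible S" by (simp add: negligible_iff_null_sets null_sets_completionI)
  then have "S = {}" using open_not_negligible[OF S] by auto
  then show ?thesis by (auto simp: S_def)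
qed

text \<open>The exceptional null set disappears because both sides are continuous in \<open>x\<close>.\<close>

lemma heat_invariant_of_AE_invariance:
  fixes G :: "real \<Rightarrow> real"
  assumes cont: "continuous_on UNIV G"
    and int: "\<And>h. h > 0 \<Longrightarrow> integrable lborel (\<lambda>y. gauss h y * G y)"
    and inv: "\<And>h. h > 0 \<Longrightarrow> AE x in lborel. G x = (\<integral>y. gauss h y * G (x + y) \<partial>lborel)"
  shows "heat_invariant G"
  unfolding heat_invariant_def
proof (intro conjI allI impI cont)
  fix h x :: real assume h: "h > 0"
  have meas: "G \<in> borel_measurable borel" using cont by (rule borel_measurable_continuous_onI)
  have int2: "integrable lborel (\<lambda>y. gauss (2 * h) y * G y)" using int[of "2 * h"] h by simp
  have "G x = (\<integral>y. gauss h y * G (x + y) \<partial>lborel)"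
    by (rule fun_cong[where x = x], rule AE_lborel_eq_imp_eq_of_continuous[OF cont
          continuous_heat_operator[OF meas int2 h] inv[OF h]])
  then show "has_bochner_integral lborel (\<lambda>y. gauss h y * G (x + y)) (G x)"
    using integrable_heat_operator[OF meas int2 h, of x]
    by (simp add: has_bochner_integral_iff)
qed

section \<open>Independent Gaussian variables\<close>

context prob_space
begin

lemma normal_charges_interval:
  assumes X: "distributed M lborel X (normal_density m s)" and s: "s > 0" and ab: "a < b"
  shows "prob (X -` {a..b} \<inter> space M) > 0"
proof (rule ccontr)
  have [measurable]: "X \<in> borel_measurable M" using distributed_measurable[OF X] by simp
  assume "\<not> ?thesis"
  then have "prob (X -` {a..b} \<inter> space M) = 0"
    using measure_nonneg[of M "X -` {a..b} \<inter> space M"] by linarith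
  then have "emeasure (distr M lborel X) {a..b} = 0"
    by (simp add: emeasure_distr emeasure_eq_measure)
  then have "{a..b} \<in> null_sets (density lborel (\<lambda>x. ennreal (normal_density m s x)))"
    by (simp add: distributed_distr_eq_density[OF X] null_setsI)
  then have "AE x in lborel. x \<in> {a..b} \<longrightarrow> ennreal (normal_density m s x) = 0"
    by (simp add: null_sets_density_iff)
  moreover have "ennreal (normal_density m s x) \<noteq> 0" for x
    using normal_density_pos[OF s, of m x] by (simp add: ennreal_eq_0_iff not_le)
  ultimately have "AE x in lborel. x \<notin> {a..b}" by simp
  then have "{a..b} \<in> null_sets lborel" by (subst AE_iff_null_sets) auto
  then show False using ab by (simp add: null_sets_def)
qed

text \<open>An almost sure property must hold somewhere on every event of positive probability. The event
  here has positive probability since Gaussians charge every interval and \<open>X\<close>, \<open>Y\<close> are independent.\<close>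

lemma AE_meets_independent_normal_intervals:
  assumes P: "AE \<omega> in M. P \<omega>" and indep: "indep_var borel X borel Y"
    and X: "distributed M lborel X (normal_density m s)" "s > 0"
    and Y: "distributed M lborel Y (normal_density m' s')" "s' > 0"
    and "a < b" "c < d"
  obtains \<omega> where "P \<omega>" "a \<le> X \<omega>" "X \<omega> \<le> b" "c \<le> Y \<omega>" "Y \<omega> \<le> d"
proof -
  define E where "E = (\<lambda>\<omega>. (X \<omega>, Y \<omega>)) -` ({a..b} \<times> {c..d}) \<inter> space M"
  have [measurable]: "X \<in> borel_measurable M" "Y \<in> borel_measurable M"
    using indep by (auto dest: indep_var_rv1 indep_var_rv2)
  have "{\<omega> \<in> space M. X \<omega> \<in> {a..b} \<and> Y \<omega> \<in> {c..d}} \<in> events" by measurable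
  then have E: "E \<in> events" by (simp add: E_def vimage_def Int_def conj_ac)
  have "prob E > 0"
    using indep_varD[OF indep, of "{a..b}" "{c..d}"] normal_charges_interval[OF X \<open>a < b\<close>]
      normal_charges_interval[OF Y \<open>c < d\<close>] by (simp add: E_def)
  then have "E \<notin> null_sets M" by (auto simp: null_sets_def emeasure_eq_measure)
  have "\<exists>\<omega>\<in>E. P \<omega>"
  proof (rule ccontr)
    assume "\<not> ?thesis"
    then have "AE \<omega> in M. \<omega> \<notin> E" using P by auto
    with E \<open>E \<notin> null_sets M\<close> show False by (simp add: AE_iff_null_sets)
  qed
  then show thesis using that by (auto simp: E_def)
qed

lemma indep_var_of_indep_sigma_algebra:
  assumes indep: "indep_set (sets N) (sets (vimage_algebra (space M) Y borel))"
    and N: "subalgebra M N" and X: "X \<in> borel_measurable N" and Y: "Y \<in> borel_measurable M"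
  shows "indep_var borel X borel (Y :: _ \<Rightarrow> real)"
  unfolding indep_var_eq
proof (intro conjI Y measurable_from_subalg[OF N X])
  have sp: "space N = space M" using N by (simp add: subalgebra_def)
  have "sigma_sets (space M) {X -` A \<inter> space M |A. A \<in> sets borel} \<subseteq> sets N"
    unfolding sp[symmetric] using measurable_sets[OF X] by (intro sets.sigma_sets_subset) auto
  then show "indep_set (sigma_sets (space M) {X -` A \<inter> space M |A. A \<in> sets borel})
      (sigma_sets (space M) {Y -` A \<inter> space M |A. A \<in> sets borel})"
    using indep unfolding indep_set_def sets_vimage_algebra
    by (rule_tac indep_sets_mono_sets) (auto split: bool.splits)
qed

text \<open>The hypothesis on \<open>B\<close> says that \<open>G X\<close> is the conditional expectation of \<open>G (X + Y)\<close> given \<open>X\<close>.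
  By independence and Fubini this conditional expectation is the Gaussian average of \<open>G\<close> around \<open>X\<close>,
  so the two functions of \<open>X\<close> agree almost everywhere for the law of \<open>X\<close>. As that law has a positive
  density, they agree Lebesgue almost everywhere.\<close>

lemma AE_heat_operator_fixed_of_set_integrals:
  fixes G :: "real \<Rightarrow> real"
  assumes indep: "indep_var borel X borel Y"
    and X: "distributed M lborel X (gauss s)" and s: "s > 0"
    and Y: "distributed M lborel Y (gauss h)"
    and G[measurable]: "G \<in> borel_measurable borel"
    and int: "integrable M (\<lambda>\<omega>. G (X \<omega>))" "integrable M (\<lambda>\<omega>. G (X \<omega> + Y \<omega>))"
    and mart: "\<And>B. B \<in> sets borel \<Longrightarrow>
      (\<integral>\<omega>. indicator B (X \<omega>) * G (X \<omega> + Y \<omega>) \<partial>M) = (\<integral>\<omega>. indicator B (X \<omega>) * G (X \<omega>) \<partial>M)"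
  shows "AE x in lborel. G x = (\<integral>y. gauss h y * G (x + y) \<partial>lborel)"
proof -
  have rv[measurable]: "X \<in> borel_measurable M" "Y \<in> borel_measurable M"
    using indep by (auto dest: indep_var_rv1 indep_var_rv2)
  define \<mu> where "\<mu> = distr M borel X"
  define \<nu> where "\<nu> = distr M borel Y"
  have joint: "\<mu> \<Otimes>\<^sub>M \<nu> = distr M (borel \<Otimes>\<^sub>M borel) (\<lambda>\<omega>. (X \<omega>, Y \<omega>))"
    using indep unfolding indep_var_distribution_eq \<mu>_def \<nu>_def by simp
  interpret \<mu>: prob_space \<mu> unfolding \<mu>_def by (rule prob_space_distr) simp
  interpret \<nu>: prob_space \<nu> unfolding \<nu>_def by (rule prob_space_distr) simp
  interpret pair_prob_space \<mu> \<nu> ..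
  have [simp, measurable_cong]: "sets \<mu> = sets borel" "sets \<nu> = sets borel"
    by (auto simp: \<mu>_def \<nu>_def)
  have pair_int: "integrable (\<mu> \<Otimes>\<^sub>M \<nu>) (\<lambda>z. f (fst z) * G (fst z + snd z))"
    and pair_eq: "(\<integral>z. f (fst z) * G (fst z + snd z) \<partial>(\<mu> \<Otimes>\<^sub>M \<nu>)) = (\<integral>\<omega>. f (X \<omega>) * G (X \<omega> + Y \<omega>) \<partial>M)"
    if [measurable]: "f \<in> borel_measurable borel" and f: "\<And>x. \<bar>f x\<bar> \<le> 1" for f :: "real \<Rightarrow> real"
  proof -
    have "integrable M (\<lambda>\<omega>. f (X \<omega>) * G (X \<omega> + Y \<omega>))"
    proof (rule Bochner_Integration.integrable_bound[OF int(2)])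
      show "AE \<omega> in M. norm (f (X \<omega>) * G (X \<omega> + Y \<omega>)) \<le> norm (G (X \<omega> + Y \<omega>))"
        using f by (auto simp: abs_mult intro!: mult_left_le_one_le)
    qed measurable
    then show "integrable (\<mu> \<Otimes>\<^sub>M \<nu>) (\<lambda>z. f (fst z) * G (fst z + snd z))"
      unfolding joint by (subst integrable_distr_eq) auto
    show "(\<integral>z. f (fst z) * G (fst z + snd z) \<partial>(\<mu> \<Otimes>\<^sub>M \<nu>)) = (\<integral>\<omega>. f (X \<omega>) * G (X \<omega> + Y \<omega>) \<partial>M)"
      unfolding joint by (subst integral_distr) auto
  qed
  have ae: "AE x in \<mu>. G x = (\<integral>y. G (x + y) \<partial>\<nu>)"
  proof (rule density_unique_real)
    show "integrable \<mu> G" unfolding \<mu>_def using int(1) by (subst integrable_distr_eq) auto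
    show "integrable \<mu> (\<lambda>x. \<integral>y. G (x + y) \<partial>\<nu>)"
      using integrable_fst'[OF pair_int[of "\<lambda>_. 1"]] by simp
    fix B assume "B \<in> sets \<mu>"
    then have B[measurable]: "B \<in> sets borel" by simp
    have "(\<integral>x\<in>B. G x \<partial>\<mu>) = (\<integral>\<omega>. indicator B (X \<omega>) * G (X \<omega>) \<partial>M)"
      unfolding set_lebesgue_integral_def \<mu>_def by (subst integral_distr) auto
    also have "\<dots> = (\<integral>\<omega>. indicator B (X \<omega>) * G (X \<omega> + Y \<omega>) \<partial>M)" using mart[OF B] by simp
    also have "\<dots> = (\<integral>x. (\<integral>y. indicator B x * G (x + y) \<partial>\<nu>) \<partial>\<mu>)"
      using integral_fst'[OF pair_int[of "indicator B"]] pair_eq[of "indicator B"] by simp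
    also have "\<dots> = (\<integral>x\<in>B. (\<integral>y. G (x + y) \<partial>\<nu>) \<partial>\<mu>)"
      by (simp add: set_lebesgue_integral_def)
    finally show "(\<integral>x\<in>B. G x \<partial>\<mu>) = (\<integral>x\<in>B. (\<integral>y. G (x + y) \<partial>\<nu>) \<partial>\<mu>)" .
  qed
  have \<mu>_eq: "\<mu> = density lborel (gauss s)"
    unfolding distributed_distr_eq_density[OF X, symmetric] \<mu>_def by (rule distr_cong) auto
  from ae have "AE x in lborel. 0 < ennreal (gauss s x) \<longrightarrow> G x = (\<integral>y. G (x + y) \<partial>\<nu>)"
    unfolding \<mu>_eq by (subst (asm) AE_density) auto
  then have "AE x in lborel. G x = (\<integral>y. G (x + y) \<partial>\<nu>)"
    by eventually_elim (use normal_density_pos[of "sqrt s" 0] s in \<open>auto\<close>)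
  moreover have "(\<integral>y. G (x + y) \<partial>\<nu>) = (\<integral>y. gauss h y * G (x + y) \<partial>lborel)" for x
    unfolding \<nu>_def
    by (subst integral_distr, simp, simp,
        subst distributed_integral[OF Y, of "\<lambda>y. G (x + y)", symmetric]) auto
  ultimately show ?thesis by simp
qed

end

section \<open>Brownian motion relative to a filtration\<close>

locale brownian_filtration = prob_space M for M :: "'a measure" +
  fixes F :: "real \<Rightarrow> 'a measure" and W :: "real \<Rightarrow> 'a \<Rightarrow> real"
  assumes filtration: "filtration_on M F"
    and brownian: "standard_brownian_motion M W"
    and adapted: "adapted F W"
    and increments: "increments_independent_of M F W"
begin

lemma subalgebra: "t \<ge> 0 \<Longrightarrow> subalgebra M (F t)"
  using filtration by (simp add: filtration_on_def)

lemma W_measurable: "t \<ge> 0 \<Longrightarrow> W t \<in> borel_measurable M"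
  using brownian by (simp add: standard_brownian_motion_def)

lemma W_start: "AE \<omega> in M. W 0 \<omega> = 0"
  using brownian by (simp add: standard_brownian_motion_def)

lemma W_continuous: "AE \<omega> in M. continuous_on {0..} (\<lambda>t. W t \<omega>)"
  using brownian by (simp add: standard_brownian_motion_def)

lemma increment_distributed:
  "0 \<le> s \<Longrightarrow> s < t \<Longrightarrow> distributed M lborel (\<lambda>\<omega>. W t \<omega> - W s \<omega>) (gauss (t - s))"
  using brownian by (simp add: standard_brownian_motion_def)

lemma W_distributed:
  assumes "t > 0"
  shows "distributed M lborel (W t) (gauss t)"
proof -
  note D = increment_distributed[of 0 t]
  have [measurable]: "W t \<in> borel_measurable M" "W 0 \<in> borel_measurable M"
    using W_measurable assms by auto
  have "distr M lborel (W t) = distr M lborel (\<lambda>\<omega>. W t \<omega> - W 0 \<omega>)"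
  proof (rule distr_cong_AE)
    show "AE \<omega> in M. W t \<omega> = W t \<omega> - W 0 \<omega>" using W_start by eventually_elim simp
  qed auto
  then show ?thesis using D assms by (simp add: distributed_def)
qed

lemma indep_var_increment:
  assumes "0 \<le> s" "s \<le> t" and X: "X \<in> borel_measurable (F s)"
  shows "indep_var borel X borel (\<lambda>\<omega>. W t \<omega> - W s \<omega>)"
proof (rule indep_var_of_indep_sigma_algebra[OF _ subalgebra[OF assms(1)] X])
  show "indep_set (sets (F s)) (sets (vimage_algebra (space M) (\<lambda>\<omega>. W t \<omega> - W s \<omega>) borel))"
    using increments assms by (simp add: increments_independent_of_def)
  show "(\<lambda>\<omega>. W t \<omega> - W s \<omega>) \<in> borel_measurable M"
    using W_measurable assms by (intro borel_measurable_diff) auto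
qed

lemma W_adapted: "t \<ge> 0 \<Longrightarrow> W t \<in> borel_measurable (F t)"
  using adapted by (simp add: adapted_def)

lemma sigma_finite_subalgebra_F: "t \<ge> 0 \<Longrightarrow> sigma_finite_subalgebra M (F t)"
  by (intro finite_measure_subalgebra_is_sigma_finite finite_measure_subalgebra.intro
      finite_measure_subalgebra_axioms.intro subalgebra finite_measure_axioms)

lemma increment_integrable:
  assumes "0 \<le> s" "s < t"
  shows "integrable M (\<lambda>\<omega>. W t \<omega> - W s \<omega>)" and "(\<integral>\<omega>. W t \<omega> - W s \<omega> \<partial>M) = 0"
proof -
  note D = increment_distributed[OF assms]
  have "has_bochner_integral lborel (\<lambda>y. gauss (t - s) y * y) 0"
    using assms by (intro gauss_moments) simp
  then show "integrable M (\<lambda>\<omega>. W t \<omega> - W s \<omega>)" "(\<integral>\<omega>. W t \<omega> - W s \<omega> \<partial>M) = 0"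
    using distributed_integrable[OF D, of "\<lambda>y. y"] distributed_integral[OF D, of "\<lambda>y. y"]
    by (auto simp: has_bochner_integral_iff)
qed

lemma W_integrable:
  assumes "t \<ge> 0"
  shows "integrable M (W t)"
proof -
  have [measurable]: "W t \<in> borel_measurable M" "W 0 \<in> borel_measurable M"
    using W_measurable assms by auto
  have "integrable M (\<lambda>\<omega>. W t \<omega> - W 0 \<omega>)"
    using increment_integrable(1)[of 0 t] assms by (cases "t = 0") auto
  moreover have "AE \<omega> in M. W t \<omega> - W 0 \<omega> = W t \<omega>" using W_start by eventually_elim simp
  ultimately show ?thesis
    using integrable_cong_AE[of "\<lambda>\<omega>. W t \<omega> - W 0 \<omega>" M "W t"] by simp
qed

text \<open>An event of the past is independent of the centred increment.\<close>

lemma set_integral_increment_zero: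
  assumes st: "0 \<le> s" "s \<le> t" and A: "A \<in> sets (F s)"
  shows "integrable M (\<lambda>\<omega>. indicator A \<omega> * (W t \<omega> - W s \<omega>))"
    and "(\<integral>\<omega>. indicator A \<omega> * (W t \<omega> - W s \<omega>) \<partial>M) = 0"
proof -
  have AM: "A \<in> events" using A subalgebra[OF st(1)] by (auto simp: subalgebra_def)
  have indep: "indep_var borel (indicator A :: _ \<Rightarrow> real) borel (\<lambda>\<omega>. W t \<omega> - W s \<omega>)"
    using A by (intro indep_var_increment st) auto
  have ind: "integrable M (indicator A :: _ \<Rightarrow> real)"
    using AM by (simp add: integrable_indicator_iff emeasure_eq_measure)
  have inc: "integrable M (\<lambda>\<omega>. W t \<omega> - W s \<omega>)" "(\<integral>\<omega>. W t \<omega> - W s \<omega> \<partial>M) = 0"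
    using increment_integrable[of s t] st by (cases "s = t"; simp)+
  show "integrable M (\<lambda>\<omega>. indicator A \<omega> * (W t \<omega> - W s \<omega>))"
    by (rule indep_var_integrable[OF indep ind inc(1)])
  show "(\<integral>\<omega>. indicator A \<omega> * (W t \<omega> - W s \<omega>) \<partial>M) = 0"
    using indep_var_lebesgue_integral[OF indep ind inc(1)] inc(2) by simp
qed

lemma martingale_scaled_W: "martingale M F (\<lambda>t \<omega>. c * W t \<omega>)"
  unfolding martingale_def
proof (intro conjI allI impI)
  show "adapted F (\<lambda>t \<omega>. c * W t \<omega>)" unfolding adapted_def
  proof (intro allI impI)
    fix t :: real assume "t \<ge> 0"
    then show "(\<lambda>\<omega>. c * W t \<omega>) \<in> borel_measurable (F t)"
      using W_adapted by (intro borel_measurable_times) auto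
  qed
  show "integrable M (\<lambda>\<omega>. c * W t \<omega>)" if "t \<ge> 0" for t using W_integrable[OF that] by simp
  fix s t :: real assume st: "0 \<le> s \<and> s \<le> t"
  interpret sigma_finite_subalgebra M "F s" using st by (intro sigma_finite_subalgebra_F) simp
  show "AE \<omega> in M. real_cond_exp M (F s) (\<lambda>\<omega>. c * W t \<omega>) \<omega> = c * W s \<omega>"
  proof (rule real_cond_exp_charact)
    show "integrable M (\<lambda>\<omega>. c * W t \<omega>)" "integrable M (\<lambda>\<omega>. c * W s \<omega>)"
      using W_integrable st by auto
    show "(\<lambda>\<omega>. c * W s \<omega>) \<in> borel_measurable (F s)"
      using W_adapted st by (intro borel_measurable_times) auto
    fix A assume A: "A \<in> sets (F s)"
    then have AM: "A \<in> events" using subalg by (auto simp: subalgebra_def)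
    have "(\<integral>\<omega>. indicator A \<omega> * W t \<omega> \<partial>M)
        = (\<integral>\<omega>. indicator A \<omega> * W s \<omega> + indicator A \<omega> * (W t \<omega> - W s \<omega>) \<partial>M)"
      by (simp add: algebra_simps)
    also have "\<dots> = (\<integral>\<omega>. indicator A \<omega> * W s \<omega> \<partial>M)"
      using set_integral_increment_zero[of s t A] A st integrable_mult_indicator[OF AM W_integrable[of s]]
      by (subst Bochner_Integration.integral_add) auto
    finally show "(\<integral>\<omega>\<in>A. c * W t \<omega> \<partial>M) = (\<integral>\<omega>\<in>A. c * W s \<omega> \<partial>M)"
      by (simp add: set_lebesgue_integral_def mult.left_commute)
  qed
qed

text \<open>Upcrossings and downcrossings of any level between times 1 and 2 have positive probability, so
  some path with both regularity properties performs them, and the deterministic crossing lemmas apply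
  to that path.\<close>

lemma continuous_of_right_continuous_along_W:
  assumes paths: "AE \<omega> in M. \<forall>t\<ge>0. continuous (at_right t) (\<lambda>s. G (W s \<omega>))"
  shows "continuous_on UNIV (G :: real \<Rightarrow> real)"
proof -
  have P: "AE \<omega> in M. continuous_on {0..} (\<lambda>t. W t \<omega>) \<and>
      (\<forall>t\<ge>0. continuous (at_right t) (\<lambda>s. G (W s \<omega>)))"
    using W_continuous paths by eventually_elim simp
  have indep: "indep_var borel (W 1) borel (\<lambda>\<omega>. W 2 \<omega> - W 1 \<omega>)"
    by (intro indep_var_increment W_adapted) auto
  have D: "distributed M lborel (\<lambda>\<omega>. W 2 \<omega> - W 1 \<omega>) (gauss (2 - 1))"
    by (rule increment_distributed) auto
  have meet: "\<exists>\<omega>. continuous_on {0..} (\<lambda>t. W t \<omega>) \<and>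
      (\<forall>t\<ge>0. continuous (at_right t) (\<lambda>s. G (W s \<omega>))) \<and>
      a \<le> W 1 \<omega> \<and> W 1 \<omega> \<le> b \<and> c \<le> W 2 \<omega> - W 1 \<omega> \<and> W 2 \<omega> - W 1 \<omega> \<le> d"
    if "a < b" "c < d" for a b c d
    by (rule AE_meets_independent_normal_intervals[OF P indep W_distributed _ D _ that])
      (simp, simp, simp, blast)
  have "isCont G x" for x
  proof -
    obtain \<omega> where path: "continuous_on {0..} (\<lambda>t. W t \<omega>)"
        "\<And>t. t \<ge> 0 \<Longrightarrow> continuous (at_right t) (\<lambda>s. G (W s \<omega>))"
        and cross: "x - 1 \<le> W 1 \<omega>" "W 1 \<omega> \<le> x" "2 \<le> W 2 \<omega> - W 1 \<omega>"
      using meet[of "x - 1" x 2 3, simplified] by blast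
    have right: "continuous (at_right x) G"
      by (rule continuous_at_right_of_upcrossing[OF path, of 1 2]) (use cross in linarith)+
    obtain \<omega> where path: "continuous_on {0..} (\<lambda>t. W t \<omega>)"
        "\<And>t. t \<ge> 0 \<Longrightarrow> continuous (at_right t) (\<lambda>s. G (W s \<omega>))"
        and cross: "x \<le> W 1 \<omega>" "W 1 \<omega> \<le> x + 1" "W 2 \<omega> - W 1 \<omega> \<le> -2"
      using meet[of x "x + 1" "-3" "-2", simplified] by blast
    have left: "continuous (at_left x) G"
      by (rule continuous_at_left_of_downcrossing[OF path, of 1 2]) (use cross in linarith)+
    show ?thesis using left right by (simp add: continuous_at_split)
  qed
  then show ?thesis by (simp add: continuous_on_eq_continuous_at)
qed

text \<open>The times 1 and \<open>1 + h\<close> suffice: \<open>W 1\<close> spreads over the whole line, and \<open>h\<close> is arbitrary.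
  Integrability against all Gaussians is integrability of \<open>G (W t)\<close> for all \<open>t\<close>.\<close>

lemma martingale_imp_heat_invariant:
  assumes mart: "martingale M F (\<lambda>t \<omega>. G (W t \<omega>))" and cont: "continuous_on UNIV G"
  shows "heat_invariant G"
proof (rule heat_invariant_of_AE_invariance[OF cont])
  have G[measurable]: "G \<in> borel_measurable borel" using cont by (rule borel_measurable_continuous_onI)
  have int: "integrable M (\<lambda>\<omega>. G (W t \<omega>))" if "t \<ge> 0" for t
    using mart that by (simp add: martingale_def)
  show "integrable lborel (\<lambda>y. gauss t y * G y)" if "t > 0" for t
    using distributed_integrable[OF W_distributed[OF that], of G] int[of t] that by simp
  fix h :: real assume h: "h > 0"
  interpret sigma_finite_subalgebra M "F 1" by (rule sigma_finite_subalgebra_F) simp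
  have X: "W 1 \<in> borel_measurable (F 1)" by (rule W_adapted) simp
  have indep: "indep_var borel (W 1) borel (\<lambda>\<omega>. W (1 + h) \<omega> - W 1 \<omega>)"
    using h by (intro indep_var_increment X) auto
  have D: "distributed M lborel (\<lambda>\<omega>. W (1 + h) \<omega> - W 1 \<omega>) (gauss h)"
    using increment_distributed[of 1 "1 + h"] h by simp
  show "AE x in lborel. G x = (\<integral>y. gauss h y * G (x + y) \<partial>lborel)"
  proof (rule AE_heat_operator_fixed_of_set_integrals[OF indep W_distributed _ D G])
    show "integrable M (\<lambda>\<omega>. G (W 1 \<omega>))" "integrable M (\<lambda>\<omega>. G (W 1 \<omega> + (W (1 + h) \<omega> - W 1 \<omega>)))"
      using int[of 1] int[of "1 + h"] h by auto
    fix B :: "real set" assume B: "B \<in> sets borel"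
    define A where "A = W 1 -` B \<inter> space M"
    have sp: "space (F 1) = space M" using subalg by (simp add: subalgebra_def)
    have A: "A \<in> sets (F 1)" using measurable_sets[OF X B] by (simp add: A_def sp)
    have ind: "indicator B (W 1 \<omega>) = (indicator A \<omega> :: real)" if "\<omega> \<in> space M" for \<omega>
      using that by (simp add: A_def indicator_def)
    have AE: "AE \<omega> in M. real_cond_exp M (F 1) (\<lambda>\<omega>. G (W (1 + h) \<omega>)) \<omega> = G (W 1 \<omega>)"
      using mart h by (simp add: martingale_def)
    have [measurable]: "W 1 \<in> borel_measurable M" by (rule W_measurable) simp
    have [measurable]: "A \<in> events" using A subalg by (auto simp: subalgebra_def)
    have "(\<integral>\<omega>. indicator B (W 1 \<omega>) * G (W 1 \<omega> + (W (1 + h) \<omega> - W 1 \<omega>)) \<partial>M)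
        = (\<integral>\<omega>\<in>A. G (W (1 + h) \<omega>) \<partial>M)"
      unfolding set_lebesgue_integral_def by (intro Bochner_Integration.integral_cong) (auto simp: ind)
    also have "\<dots> = (\<integral>\<omega>\<in>A. real_cond_exp M (F 1) (\<lambda>\<omega>. G (W (1 + h) \<omega>)) \<omega> \<partial>M)"
      using int[of "1 + h"] h A by (intro real_cond_exp_intA) auto
    also have "\<dots> = (\<integral>\<omega>\<in>A. G (W 1 \<omega>) \<partial>M)"
      unfolding set_lebesgue_integral_def
    proof (rule integral_cong_AE)
      show "AE \<omega> in M. indicat_real A \<omega> *\<^sub>R real_cond_exp M (F 1) (\<lambda>\<omega>. G (W (1 + h) \<omega>)) \<omega>
          = indicat_real A \<omega> *\<^sub>R G (W 1 \<omega>)"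
        using AE by eventually_elim simp
    qed (use borel_measurable_cond_exp2 in measurable)
    also have "\<dots> = (\<integral>\<omega>. indicator B (W 1 \<omega>) * G (W 1 \<omega>) \<partial>M)"
      unfolding set_lebesgue_integral_def by (intro Bochner_Integration.integral_cong) (auto simp: ind)
    finally show "(\<integral>\<omega>. indicator B (W 1 \<omega>) * G (W 1 \<omega> + (W (1 + h) \<omega> - W 1 \<omega>)) \<partial>M)
        = (\<integral>\<omega>. indicator B (W 1 \<omega>) * G (W 1 \<omega>) \<partial>M)" .
  qed auto
qed

end

section \<open>The characterisation\<close>

theorem theorem3p1:
  fixes M :: "'a measure"
    and F :: "real \<Rightarrow> 'a measure"
    and W :: "real \<Rightarrow> 'a \<Rightarrow> real"
    and G :: "real \<Rightarrow> real"
  assumes "prob_space M"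
    and "complete_measure M"
    and "filtration_on M F"
    and "usual_conditions M F"
    and "standard_brownian_motion M W"
    and "adapted F W"
    and "increments_independent_of M F W"
    and "\<exists>B. standard_brownian_motion M B \<and> adapted F B \<and> independent_processes M W B"
  shows "(G \<in> borel_measurable lebesgue \<and>
            (\<forall>x y :: real. G (x\<^sup>2 - y\<^sup>2) = G (x\<^sup>2) - G (y\<^sup>2)))
     \<longleftrightarrow>
         (martingale M F (\<lambda>t \<omega>. G (W t \<omega>)) \<and>
          (AE \<omega> in M. \<forall>t\<ge>0. continuous (at_right t) (\<lambda>s. G (W s \<omega>))) \<and>
          (AE \<omega> in M. G (W 0 \<omega>) = 0))"
    (is "?Cauchy \<longleftrightarrow> ?martingale")
proof -
  interpret prob_space M by fact
  interpret brownian_filtration M F W by unfold_locales fact+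
  show ?thesis
  proof
    assume G: ?Cauchy
    define c where "c = G 1"
    have "G (x + y) = G x + G y" for x y
      using G by (intro conditional_Cauchy_imp_additive) blast
    then have linear: "G x = x * G 1" for x
      using G by (intro lebesgue_measurable_additive_linear) blast+
    have G_eq: "G = (\<lambda>x. c * x)"
      by (rule ext, subst linear) (simp only: c_def mult.commute)
    have "AE \<omega> in M. \<forall>t\<ge>0. continuous (at_right t) (\<lambda>s. c * W s \<omega>)"
      using W_continuous
    proof eventually_elim
      case (elim \<omega>)
      show ?case
      proof (intro allI impI)
        fix t :: real assume "t \<ge> 0"
        then have "continuous (at t within {0..}) (\<lambda>s. W s \<omega>)"
          using elim by (simp add: continuous_on_eq_continuous_within)
        then have "continuous (at_right t) (\<lambda>s. W s \<omega>)"
          by (rule continuous_within_subset) (use \<open>t \<ge> 0\<close> in auto)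
        then show "continuous (at_right t) (\<lambda>s. c * W s \<omega>)" by (intro continuous_intros)
      qed
    qed
    moreover have "AE \<omega> in M. c * W 0 \<omega> = 0" using W_start by eventually_elim simp
    ultimately show ?martingale using martingale_scaled_W[of c] by (simp add: G_eq)
  next
    assume R: ?martingale
    have "AE \<omega> in M. G 0 = 0"
      using conjunct2[OF conjunct2[OF R]] W_start by eventually_elim simp
    then have G0: "G 0 = 0" by simp
    have "continuous_on UNIV G" using R by (intro continuous_of_right_continuous_along_W) simp
    then have "heat_invariant G" using R by (intro martingale_imp_heat_invariant) simp
    then have linear: "G x = x * G 1" for x using G0 by (rule heat_invariant_imp_linear)
    define c where "c = G 1"
    have G_eq: "G = (\<lambda>x. c * x)"
      by (rule ext, subst linear) (simp only: c_def mult.commute)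
    have "(\<lambda>x :: real. c * x) \<in> borel_measurable lebesgue"
      by (intro borel_measurable_times borel_measurable_const) (simp add: measurable_completion)
    then show ?Cauchy by (simp add: G_eq right_diff_distrib)
  qed
qed

end
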